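(* Let $q$ be a power of a prime $p$. If there exists an $\mathbf{F}_q$-linear $[[n,k,r,d]]_q$ subsystem code with $k>1$ that is pure to $d'$, then there exists an $\mathbf{F}_q$-linear $[[n,k-1,r+1,\ge d]]_q$ subsystem code that is pure to $\min\{d,d'\}$. If a pure $\mathbf{F}_q$-linear $[[n,1,r,d]]_q$ subsystem code exists, then there exists an $\mathbf{F}_q$-linear $[[n,0,r+1,d]]_q$ subsystem code.
   Context: For $(x|y)\in\mathbf{F}_q^{2n}$ (with $x,y\in\mathbf{F}_q^n$), $\mathrm{swt}(x|y)$ is the number of $i$ with $(x_i,y_i)\ne(0,0)$, and $\mathrm{swt}(S)$ is the minimum of $\mathrm{swt}$ over the nonzero elements of $S$. The trace-symplectic product of $(a|b)$ and $(a'|b')$ is $\mathrm{tr}_{q/p}(a'\cdot b-a\cdot b')$, and $C^{\perp_s}$ is the dual of $C\subseteq\mathbf{F}_q^{2n}$ with respect to it. All subsystem codes are Clifford subsystem codes: an $((n,K,R,d))_q$ subsystem code is a subspace $Q=A\otimes B$ of $\mathbf{C}^{q^n}$, $\dim A=K$, $\dim B=R$, arising from an additive code; concretely, its existence means that there is an additive subgroup $C\le\mathbf{F}_q^{2n}$ (the zero code is allowed) with $D=C\cap C^{\perp_s}$ such that $|C|=q^nR/K$, $|D|=q^n/(KR)$, and $d=\mathrm{swt}(D^{\perp_s}\setminus C)$ if $D^{\perp_s}\ne C$, while $d=\mathrm{swt}(D^{\perp_s})$ if $D^{\perp_s}=C$ (the case $K=1$). The subsystem code is $\mathbf{F}_q$-linear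 if $C$ is an $\mathbf{F}_q$-linear subspace of $\mathbf{F}_q^{2n}$. $[[n,k,r,d]]_q$ means $((n,q^k,q^r,d))_q$; writing $\ge d$ in the last position means that the minimum distance is some $\tilde d\ge d$. The code derived from $C$ is pure to $d'$ if $C$ contains no nonzero element of symplectic weight less than $d'$; it is pure if it is pure to its minimum distance $d$. *)

theory Defs
  imports "HOL-Analysis.Analysis" "HOL-Number_Theory.Residues"
begin

text \<open>
  The type \<open>'a\<close> is the finite field with \<open>q = CARD('a)\<close> elements, the length is \<open>n = CARD('n)\<close>,
  and a vector \<open>(x|y)\<close> of length \<open>2n\<close> is an element of \<open>'a ^ ('n + 'n)\<close>: the coordinates
  \<open>Inl i\<close> form \<open>x\<close> and the coordinates \<open>Inr i\<close> form \<open>y\<close>.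
\<close>

definition xpart :: "'a ^ ('n + 'n) \<Rightarrow> 'a ^ 'n" where
  "xpart v = (\<chi> i. v $ Inl i)"

definition ypart :: "'a ^ ('n + 'n) \<Rightarrow> 'a ^ 'n" where
  "ypart v = (\<chi> i. v $ Inr i)"

definition swt :: "'a::zero ^ ('n::finite + 'n) \<Rightarrow> nat" where
  "swt v = card {i. (xpart v $ i, ypart v $ i) \<noteq> (0, 0)}"

definition min_swt :: "('a::{zero,finite} ^ ('n::finite + 'n)) set \<Rightarrow> nat" where
  "min_swt S = Min (swt ` (S - {0}))"

text \<open>
  The absolute trace \<open>x + x^p + ... + x^(p^(m-1))\<close>, where \<open>p = CHAR('a)\<close> and \<open>CARD('a) = p^m\<close>;
  \<open>i < m\<close> is expressed as \<open>p^i < CARD('a)\<close> (see \<open>field_trace_eq\<close> below). Its values lie in the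
  prime subfield, which is viewed inside \<open>'a\<close>.
\<close>

definition field_trace :: "'a::{field,finite} \<Rightarrow> 'a" where
  "field_trace x = (\<Sum>i | CHAR('a) ^ i < CARD('a). x ^ (CHAR('a) ^ i))"

lemma field_trace_eq:
  fixes x :: "'a::{field,finite}"
  assumes p: "prime p" and q: "CARD('a) = p ^ m"
  shows "field_trace x = (\<Sum>i<m. x ^ (p ^ i))"
proof -
  have "CHAR('a) > 0"
    by (rule finite_imp_CHAR_pos) simp
  then have "prime CHAR('a)"
    by (rule prime_CHAR_semidom)
  moreover have "CHAR('a) dvd p ^ m"
    using CHAR_dvd_CARD[where 'a = 'a] q by simp
  ultimately have ch: "CHAR('a) = p"
    using p prime_dvd_power primes_dvd_imp_eq by blast
  have "{i. p ^ i < p ^ m} = {..<m}"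
    using prime_gt_1_nat[OF p] by (auto simp: power_strict_increasing_iff)
  then show ?thesis
    by (simp add: field_trace_def ch q)
qed

definition trace_symp ::
    "'a::{field,finite} ^ ('n::finite + 'n) \<Rightarrow> 'a ^ ('n + 'n) \<Rightarrow> 'a" where
  "trace_symp u v = field_trace
     (scalar_product (xpart v) (ypart u) - scalar_product (xpart u) (ypart v))"

definition symp_dual ::
    "('a::{field,finite} ^ ('n::finite + 'n)) set \<Rightarrow> ('a ^ ('n + 'n)) set" where
  "symp_dual C = {u. \<forall>v\<in>C. trace_symp u v = 0}"

definition additive_code :: "('a::{field,finite} ^ ('n::finite + 'n)) set \<Rightarrow> bool" where
  "additive_code C \<longleftrightarrow> 0 \<in> C \<and> (\<forall>u\<in>C. \<forall>v\<in>C. u + v \<in> C) \<and> (\<forall>u\<in>C. - u \<in> C)"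

text \<open>
  \<open>subsystem_code C K R d\<close>: the additive code \<open>C\<close> yields an \<open>((n,K,R,d))_q\<close> (Clifford) subsystem
  code. The minima are over nonempty sets: always \<open>C \<subseteq> D\<^sup>\<bottom>\<close>, so if \<open>D\<^sup>\<bottom> \<noteq> C\<close> then \<open>D\<^sup>\<bottom> - C\<close> contains
  a nonzero vector; and \<open>D\<^sup>\<bottom> = C = {0}\<close> is impossible because \<open>{0}\<^sup>\<bottom>\<close> is the whole space.
\<close>

definition subsystem_code ::
    "('a::{field,finite} ^ ('n::finite + 'n)) set \<Rightarrow> nat \<Rightarrow> nat \<Rightarrow> nat \<Rightarrow> bool" where
  "subsystem_code C K R d \<longleftrightarrow>
     additive_code C \<and>
     (let q = CARD('a); n = CARD('n); D = C \<inter> symp_dual C in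
        real (card C) = real q ^ n * real R / real K \<and>
        real (card D) = real q ^ n / (real K * real R) \<and>
        d = (if symp_dual D \<noteq> C then min_swt (symp_dual D - C) else min_swt (symp_dual D)))"

text \<open>
  \<open>linear_subsystem_code C k r d\<close>: the code \<open>C\<close> yields a linear \<open>[[n,k,r,d]]_q\<close> subsystem code.
\<close>

definition linear_subsystem_code ::
    "('a::{field,finite} ^ ('n::finite + 'n)) set \<Rightarrow> nat \<Rightarrow> nat \<Rightarrow> nat \<Rightarrow> bool" where
  "linear_subsystem_code C k r d \<longleftrightarrow>
     vec.subspace C \<and> subsystem_code C (CARD('a) ^ k) (CARD('a) ^ r) d"

definition pure_to :: "('a::{field,finite} ^ ('n::finite + 'n)) set \<Rightarrow> nat \<Rightarrow> bool" where
  "pure_to C d' \<longleftrightarrow> (\<forall>v\<in>C. v \<noteq> 0 \<longrightarrow> \<not> swt v < d')"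

end

theory Submission
  imports Defs "HOL-Computational_Algebra.Polynomial"
begin

text \<open>
  Let \<open>D = C \<inter> C\<^sup>\<bottom>\<close>. For \<open>k \<ge> 1\<close> a cardinality count gives \<open>u \<in> C\<^sup>\<bottom> - C\<close>, and \<open>C\<^sup>\<bottom>\<^sup>\<bottom> = C\<close> gives
  \<open>v \<in> C\<^sup>\<bottom>\<close> with \<open>\<langle>u, v\<rangle> \<noteq> 0\<close>. Adjoining the hyperbolic pair \<open>u, v\<close> to \<open>C\<close> multiplies \<open>|C|\<close> by \<open>q\<^sup>2\<close>
  without changing \<open>D\<close>: a qudit of the subsystem \<open>A\<close> becomes a gauge qudit. The new code \<open>C'\<close> lies in
  \<open>D\<^sup>\<bottom>\<close>, so \<open>D\<^sup>\<bottom> - C'\<close> can only lose vectors and the vectors of \<open>C' - C\<close> have weight at least \<open>d\<close>.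
  If \<open>k = 1\<close>, then \<open>C' = D\<^sup>\<bottom>\<close>, whose minimum weight is \<open>d\<close> by purity.
\<close>

section \<open>Linear functionals and the trace over a finite field\<close>

text \<open>Every \<open>v \<in> S\<close> is uniquely a zero of \<open>f\<close> plus a multiple of
  \<open>w\<close>, the coefficient being \<open>f v / f w\<close>.\<close>

lemma card_subspace_zero_set:
  fixes S :: "('a::{field,finite} ^ 'm::finite) set"
  assumes S: "vec.subspace S"
    and add: "\<And>u v. f (u + v) = f u + f v" and scale: "\<And>c v. f (c *s v) = c * (f v :: 'a)"
    and w: "w \<in> S" "f w \<noteq> 0"
  shows "card {v \<in> S. f v = 0} * CARD('a) = card S"
proof -
  let ?K = "{v \<in> S. f v = 0}"
  have diff: "f (u - v) = f u - f v" for u v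
    using add[of "u - v" v] by simp
  have "bij_betw (\<lambda>(v, a). v + a *s w) (?K \<times> UNIV) S"
  proof (rule bij_betw_byWitness[where f' = "\<lambda>v. (v - (f v / f w) *s w, f v / f w)"])
    show "\<forall>x\<in>?K \<times> UNIV. (\<lambda>v. (v - (f v / f w) *s w, f v / f w)) ((\<lambda>(v, a). v + a *s w) x) = x"
      using w by (auto simp: add scale)
    show "\<forall>x\<in>S. (\<lambda>(v, a). v + a *s w) ((\<lambda>v. (v - (f v / f w) *s w, f v / f w)) x) = x"
      by auto
    show "(\<lambda>(v, a). v + a *s w) ` (?K \<times> UNIV) \<subseteq> S"
      using S w by (auto intro: vec.subspace_add vec.subspace_scale)
    show "(\<lambda>v. (v - (f v / f w) *s w, f v / f w)) ` S \<subseteq> ?K \<times> UNIV"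
      using S w by (auto intro: vec.subspace_diff vec.subspace_scale simp: diff scale)
  qed
  from bij_betw_same_card[OF this] show ?thesis
    by (simp add: card_cartesian_product)
qed

lemma CARD_field_gt_1: "CARD('a::{field,finite}) > 1"
  using card_mono[of UNIV "{0, 1::'a}"] by simp

lemma field_trace_0: "field_trace (0::'a::{field,finite}) = 0"
proof -
  have "CHAR('a) > 0"
    by (rule finite_imp_CHAR_pos) simp
  then show ?thesis
    by (auto simp: field_trace_def intro!: sum.neutral)
qed

text \<open>The trace is a nonzero polynomial of degree less than \<open>q\<close>, hence not identically zero.\<close>

lemma ex_field_trace_nonzero: "\<exists>x::'a::{field,finite}. field_trace x \<noteq> 0"
proof (rule ccontr)
  assume "\<not> ?thesis"
  then have zero: "field_trace x = 0" for x :: 'a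
    by blast
  let ?p = "CHAR('a)" and ?q = "CARD('a)"
  let ?I = "{i. ?p ^ i < ?q}"
  define P :: "'a poly" where "P = (\<Sum>i\<in>?I. Polynomial.monom 1 (?p ^ i))"
  have "?p > 0"
    by (rule finite_imp_CHAR_pos) simp
  then have p1: "?p > 1"
    using prime_CHAR_semidom prime_gt_1_nat by blast
  have q1: "?q > 1"
    by (rule CARD_field_gt_1)
  have "?I \<subseteq> {..<?q}"
    using p1 by (auto intro: less_trans[OF power_gt_expt])
  then have fin: "finite ?I"
    by (rule finite_subset) simp
  have one: "?p ^ i = 1 \<longleftrightarrow> i = 0" for i
    using p1 by auto
  \<comment> \<open>Only \<open>i = 0\<close> gives the exponent 1, and \<open>0 \<in> ?I\<close>
    because \<open>?q > 1\<close>.\<close>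
  have "Polynomial.coeff P 1 = (\<Sum>i\<in>?I. if i = 0 then 1 else 0)"
    unfolding P_def Polynomial.coeff_sum Polynomial.coeff_monom by (simp only: one)
  also have "\<dots> = 1"
    using fin q1 by simp
  finally have "P \<noteq> 0"
    by auto
  have "Polynomial.degree P \<le> ?q - 1"
    unfolding P_def
    by (rule Polynomial.degree_sum_le[OF fin]) (auto simp: Polynomial.degree_monom_eq)
  have "poly P x = field_trace x" for x
    by (simp add: P_def field_trace_def poly_sum poly_monom)
  then have "{x. poly P x = 0} = UNIV"
    by (simp add: zero)
  then have "?q \<le> Polynomial.degree P"
    using card_poly_roots_bound[OF \<open>P \<noteq> 0\<close>] by simp
  then show False
    using \<open>Polynomial.degree P \<le> ?q - 1\<close> q1 by linarith
qed

section \<open>The symplectic form and duality of linear codes\<close>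

text \<open>The argument of the trace in \<open>trace_symp\<close>. It is bilinear over the whole
  field, and for linear codes it defines the same dual.\<close>

definition symp :: "'a::field ^ ('n::finite + 'n) \<Rightarrow> 'a ^ ('n + 'n) \<Rightarrow> 'a" where
  "symp u v = scalar_product (xpart v) (ypart u) - scalar_product (xpart u) (ypart v)"

lemma symp_add_right: "symp u (v + w) = symp u v + symp u w"
  by (simp add: symp_def scalar_product_def xpart_def ypart_def algebra_simps sum.distrib)

lemma symp_scale_right: "symp u (c *s v) = c * symp u v"
  by (simp add: symp_def scalar_product_def xpart_def ypart_def algebra_simps sum_distrib_left)

lemma symp_swap: "symp v u = - symp u v"
  by (simp add: symp_def scalar_product_def mult.commute)

lemma symp_self: "symp u u = 0"
  by (simp add: symp_def)

lemma symp_add_left: "symp (v + w) u = symp v u + symp w u"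
  using symp_add_right[of u v w] by (simp add: symp_swap[of _ u])

lemma symp_scale_left: "symp (c *s v) u = c * symp v u"
  using symp_scale_right[of u c v] by (simp add: symp_swap[of _ u])

lemma symp_0_left: "symp 0 u = 0" and symp_0_right: "symp u 0 = 0"
  using symp_scale_left[of 0 0 u] symp_scale_right[of u 0 0] by simp_all

lemmas symp_bilinear =
  symp_add_left symp_add_right symp_scale_left symp_scale_right symp_0_left symp_0_right

text \<open>Pairing with the unit vector at the mirrored position reads off a coordinate of
  \<open>u\<close> up to sign.\<close>

lemma symp_nondegenerate:
  fixes u :: "'a::field ^ ('n::finite + 'n)"
  assumes "u \<noteq> 0"
  shows "\<exists>v. symp u v \<noteq> 0"
proof -
  obtain j where j: "u $ j \<noteq> 0"
    using assms by (auto simp: vec_eq_iff)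
  show ?thesis
  proof (cases j)
    case (Inl i)
    have "symp u (axis (Inr i) 1) = - u $ Inl i"
      by (simp add: symp_def scalar_product_def xpart_def ypart_def axis_def mult_delta_right)
    then show ?thesis
      using j Inl by (intro exI[of _ "axis (Inr i) 1"]) simp
  next
    case (Inr i)
    have "symp u (axis (Inl i) 1) = u $ Inr i"
      by (simp add: symp_def scalar_product_def xpart_def ypart_def axis_def mult_delta_left)
    then show ?thesis
      using j Inr by (intro exI[of _ "axis (Inl i) 1"]) simp
  qed
qed

text \<open>If \<open>symp u v \<noteq> 0\<close>, the pairings of \<open>u\<close> with the
  multiples of \<open>v\<close> take every value in the field, including one of nonzero
  trace.\<close>

lemma symp_dual_subspace_iff:
  fixes S :: "('a::{field,finite} ^ ('n::finite + 'n)) set"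
  assumes "vec.subspace S"
  shows "u \<in> symp_dual S \<longleftrightarrow> (\<forall>v\<in>S. symp u v = 0)"
proof
  assume u: "u \<in> symp_dual S"
  show "\<forall>v\<in>S. symp u v = 0"
  proof (rule ballI, rule ccontr)
    fix v assume v: "v \<in> S" "symp u v \<noteq> 0"
    obtain x :: 'a where x: "field_trace x \<noteq> 0"
      using ex_field_trace_nonzero by blast
    have "(x / symp u v) *s v \<in> S"
      using assms v by (intro vec.subspace_scale)
    then have "field_trace (symp u ((x / symp u v) *s v)) = 0"
      using u by (auto simp: symp_dual_def trace_symp_def symp_def)
    then show False
      using x v by (simp add: symp_scale_right)
  qed
next
  assume "\<forall>v\<in>S. symp u v = 0"
  then show "u \<in> symp_dual S"
    by (auto simp: symp_dual_def trace_symp_def symp_def[symmetric] field_trace_0)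
qed

lemma subspace_symp_dual:
  fixes S :: "('a::{field,finite} ^ ('n::finite + 'n)) set"
  assumes "vec.subspace S"
  shows "vec.subspace (symp_dual S)"
proof -
  have "symp_dual S = {u. \<forall>v\<in>S. symp u v = 0}"
    using symp_dual_subspace_iff[OF assms] by blast
  then show ?thesis
    by (simp add: vec.subspace_def symp_bilinear)
qed

text \<open>
  Counting the pairs \<open>(u, v)\<close> with \<open>v \<in> S\<close> and \<open>\<langle>u, v\<rangle> = 0\<close> in two ways: a fibre is the whole space
  or a hyperplane.
\<close>

lemma card_mult_card_symp_dual:
  fixes S :: "('a::{field,finite} ^ ('n::finite + 'n)) set"
  assumes S: "vec.subspace S"
  shows "card S * card (symp_dual S) = CARD('a) ^ (2 * CARD('n))"
proof -
  let ?q = "CARD('a)" and ?V = "UNIV :: ('a ^ ('n + 'n)) set"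
  let ?N = "card {(u, v). u \<in> ?V \<and> v \<in> S \<and> symp u v = 0}"
  have cV: "card ?V = ?q ^ (2 * CARD('n))"
    by (simp add: mult_2)
  have q1: "?q > 1"
    by (rule CARD_field_gt_1)
  have "{(u, v). u \<in> ?V \<and> v \<in> S \<and> symp u v = 0} = (SIGMA u:?V. {v \<in> S. symp u v = 0})"
    by auto
  then have "?N = (\<Sum>u\<in>?V. card {v \<in> S. symp u v = 0})"
    by (simp only:) simp
  \<comment> \<open>The factor \<open>?q\<close> avoids division: a hyperplane contributes
    \<open>card S\<close>, a full fibre has the surplus \<open>card S * (?q - 1)\<close>.\<close>
  then have "?N * ?q = (\<Sum>u\<in>?V. card {v \<in> S. symp u v = 0} * ?q)"
    by (simp add: sum_distrib_right)
  also have "\<dots> = (\<Sum>u\<in>?V. card S + (if u \<in> symp_dual S then card S * (?q - 1) else 0))"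
  proof (rule sum.cong[OF refl])
    fix u :: "'a ^ ('n + 'n)"
    show "card {v \<in> S. symp u v = 0} * ?q
        = card S + (if u \<in> symp_dual S then card S * (?q - 1) else 0)"
    proof (cases "u \<in> symp_dual S")
      case True
      then have "{v \<in> S. symp u v = 0} = S"
        by (auto simp: symp_dual_subspace_iff[OF S])
      with True q1 show ?thesis
        by (simp add: algebra_simps)
    next
      case False
      then obtain w where "w \<in> S" "symp u w \<noteq> 0"
        by (auto simp: symp_dual_subspace_iff[OF S])
      then have "card {v \<in> S. symp u v = 0} * ?q = card S"
        by (intro card_subspace_zero_set[OF S, of "symp u"]) (simp_all add: symp_bilinear)
      with False show ?thesis by simp
    qed
  qed
  also have "\<dots> = card ?V * card S + card (symp_dual S) * (card S * (?q - 1))"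
    by (simp add: sum.distrib sum.If_cases)
  finally have 1: "?N * ?q = \<dots>" .
  \<comment> \<open>Now the sum runs over \<open>v\<close>; by nondegeneracy only
    \<open>v = 0\<close> has a fibre larger than a hyperplane.\<close>
  have "{(u, v). u \<in> ?V \<and> v \<in> S \<and> symp u v = 0}
      = (\<lambda>(v, u). (u, v)) ` (SIGMA v:S. {u. symp u v = 0})"
    by auto
  then have "?N = (\<Sum>v\<in>S. card {u. symp u v = 0})"
    by (simp add: card_image inj_on_def split_def prod_eq_iff)
  then have "?N * ?q = (\<Sum>v\<in>S. card {u. symp u v = 0} * ?q)"
    by (simp add: sum_distrib_right)
  also have "\<dots> = (\<Sum>v\<in>S. card ?V + (if v = 0 then card ?V * (?q - 1) else 0))"
  proof (rule sum.cong[OF refl])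
    fix v :: "'a ^ ('n + 'n)"
    show "card {u. symp u v = 0} * ?q = card ?V + (if v = 0 then card ?V * (?q - 1) else 0)"
    proof (cases "v = 0")
      case True
      with q1 show ?thesis
        by (simp add: symp_bilinear diff_mult_distrib2 del: CARD_vec)
    next
      case False
      then obtain w where "symp v w \<noteq> 0"
        using symp_nondegenerate by blast
      then have "symp w v \<noteq> 0"
        by (simp add: symp_swap[of w v])
      then have "card {u \<in> ?V. symp u v = 0} * ?q = card ?V"
        by (intro card_subspace_zero_set[OF vec.subspace_UNIV, of "\<lambda>u. symp u v"])
          (simp_all add: symp_bilinear)
      with False show ?thesis by simp
    qed
  qed
  also have "\<dots> = card S * card ?V + card ?V * (?q - 1)"
    using vec.subspace_0[OF S] by (simp add: sum.distrib del: CARD_vec)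
  finally have 2: "?N * ?q = \<dots>" .
  \<comment> \<open>Both counts contain \<open>card S * card ?V\<close>; cancelling it leaves the
    surplus terms.\<close>
  from 1 2 have "card S * card (symp_dual S) * (?q - 1) = card ?V * (?q - 1)"
    by (simp add: algebra_simps del: CARD_vec)
  then show ?thesis
    using q1 by (simp add: cV del: CARD_vec)
qed

text \<open>Antisymmetry of \<open>symp\<close> gives one inclusion; the product formula for
  \<open>S\<close> and for its dual shows that both sides have the same size.\<close>

lemma symp_dual_symp_dual:
  fixes S :: "('a::{field,finite} ^ ('n::finite + 'n)) set"
  assumes S: "vec.subspace S"
  shows "symp_dual (symp_dual S) = S"
proof -
  note S' = subspace_symp_dual[OF S]
  have sub: "S \<subseteq> symp_dual (symp_dual S)"
  proof
    fix u assume "u \<in> S"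
    then show "u \<in> symp_dual (symp_dual S)"
      by (auto simp: symp_dual_subspace_iff[OF S'] symp_dual_subspace_iff[OF S] symp_swap[of u])
  qed
  have "card (symp_dual S) * card (symp_dual (symp_dual S)) = card (symp_dual S) * card S"
    using card_mult_card_symp_dual[OF S] card_mult_card_symp_dual[OF S'] by (simp add: mult.commute)
  moreover have "card (symp_dual S) > 0"
    using vec.subspace_0[OF S'] by (auto simp: card_gt_0_iff)
  ultimately have "card S = card (symp_dual (symp_dual S))"
    by (metis mult_left_cancel less_not_refl)
  then show ?thesis
    using sub card_subset_eq[OF _ sub] by simp
qed

section \<open>Enlarging a linear code by a hyperbolic pair\<close>

text \<open>The vectors \<open>u\<close> and \<open>v\<close> are orthogonal to \<open>C\<close> and
  each to itself, but not to each other. Hence pairing \<open>c + a *s u + b *s v\<close> with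
  \<open>u\<close> and \<open>v\<close> recovers \<open>b\<close> and \<open>a\<close>, which yields
  both the cardinality and the unchanged radical.\<close>

lemma adjoin_hyperbolic_pair:
  fixes C :: "('a::{field,finite} ^ ('n::finite + 'n)) set"
  assumes C: "vec.subspace C" and proper: "\<not> symp_dual C \<subseteq> C"
  obtains C' where "vec.subspace C'" "C \<subseteq> C'" "C' \<inter> symp_dual C' = C \<inter> symp_dual C"
    "card C' = card C * CARD('a)\<^sup>2"
proof -
  note C\<^sub>d = subspace_symp_dual[OF C]
  note dual = symp_dual_subspace_iff[OF C]
  obtain u where u: "u \<in> symp_dual C" "u \<notin> C"
    using proper by blast
  then have "u \<notin> symp_dual (symp_dual C)"
    by (simp add: symp_dual_symp_dual[OF C])
  then obtain v where v: "v \<in> symp_dual C" and uv: "symp u v \<noteq> 0"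
    by (auto simp: symp_dual_subspace_iff[OF C\<^sub>d])
  have vu: "symp v u \<noteq> 0"
    using uv by (simp add: symp_swap[of v u])
  define g where "g = (\<lambda>(c, a, b). c + a *s u + b *s v)"
  define C' where "C' = g ` (C \<times> UNIV)"
  have u_C: "symp u c = 0" "symp c u = 0" and v_C: "symp v c = 0" "symp c v = 0" if "c \<in> C" for c
    using u v that by (auto simp: dual symp_swap[of c])
  have pair: "symp (g (c, a, b)) u = b * symp v u" "symp (g (c, a, b)) v = a * symp u v"
    if "c \<in> C" for c a b
    using that by (simp_all add: g_def symp_bilinear u_C v_C symp_self)
  have sub: "vec.subspace C'"
    unfolding vec.subspace_def
  proof (intro conjI ballI allI)
    have "g (0, 0, 0) \<in> C'"
      unfolding C'_def using vec.subspace_0[OF C] by blast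
    then show "0 \<in> C'"
      by (simp add: g_def)
  next
    fix x y assume "x \<in> C'" "y \<in> C'"
    then obtain c a b c' a' b' where "c \<in> C" "c' \<in> C" "x = g (c, a, b)" "y = g (c', a', b')"
      by (auto simp: C'_def)
    then have "x + y = g (c + c', a + a', b + b')" "c + c' \<in> C"
      using C by (auto simp: g_def algebra_simps vec.scale_left_distrib intro: vec.subspace_add)
    then show "x + y \<in> C'"
      unfolding C'_def by blast
  next
    fix s x assume "x \<in> C'"
    then obtain c a b where "c \<in> C" "x = g (c, a, b)"
      by (auto simp: C'_def)
    then have "s *s x = g (s *s c, s * a, s * b)" "s *s c \<in> C"
      using C by (auto simp: g_def vec.scale_right_distrib intro: vec.subspace_scale)
    then show "s *s x \<in> C'"
      unfolding C'_def by blast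
  qed
  have "c = g (c, 0, 0)" for c
    by (simp add: g_def)
  then have CC': "C \<subseteq> C'"
    unfolding C'_def by blast
  have "u = g (0, 1, 0)" "v = g (0, 0, 1)"
    by (simp_all add: g_def)
  then have uC': "u \<in> C'" and vC': "v \<in> C'"
    unfolding C'_def using vec.subspace_0[OF C] by blast+
  have "C' \<inter> symp_dual C' = C \<inter> symp_dual C"
  proof (intro equalityI subsetI)
    fix x assume x: "x \<in> C' \<inter> symp_dual C'"
    then obtain c a b where c: "c \<in> C" "x = g (c, a, b)"
      by (auto simp: C'_def)
    have "symp x u = 0" "symp x v = 0" and xC: "\<forall>y\<in>C. symp x y = 0"
      using x uC' vC' CC' by (auto simp: symp_dual_subspace_iff[OF sub])
    then have "a = 0" "b = 0"
      using c uv vu by (simp_all add: pair)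
    then have "x = c"
      using c by (simp add: g_def)
    then show "x \<in> C \<inter> symp_dual C"
      using c xC by (simp add: dual)
  next
    \<comment> \<open>Since \<open>x\<close> lies in \<open>C\<close>, it is orthogonal to
      \<open>u\<close> and \<open>v\<close> as well.\<close>
    fix x assume x: "x \<in> C \<inter> symp_dual C"
    then have "symp x (g (c, a, b)) = 0" if "c \<in> C" for c a b
      using that by (simp add: g_def symp_bilinear u_C v_C dual)
    then have "x \<in> symp_dual C'"
      unfolding symp_dual_subspace_iff[OF sub] unfolding C'_def by auto
    then show "x \<in> C' \<inter> symp_dual C'"
      using x CC' by blast
  qed
  moreover have "inj_on g (C \<times> UNIV)"
  proof (rule inj_onI)
    fix x y assume "x \<in> C \<times> UNIV" "y \<in> C \<times> UNIV" and eq: "g x = g y"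
    then obtain c a b c' a' b' where xy: "x = (c, a, b)" "y = (c', a', b')" and "c \<in> C" "c' \<in> C"
      by auto
    then have "b * symp v u = b' * symp v u" "a * symp u v = a' * symp u v"
      using eq by (metis pair)+
    then have "a = a'" "b = b'"
      using uv vu by simp_all
    then show "x = y"
      using eq by (simp add: xy g_def)
  qed
  then have "card C' = card C * CARD('a)\<^sup>2"
    by (simp add: C'_def card_image card_cartesian_product power2_eq_square)
  ultimately show thesis
    using that sub CC' by blast
qed

section \<open>Parameters and weights of linear subsystem codes\<close>

text \<open>Clearing denominators leaves equations between natural numbers, so that exponents can be
  compared.\<close>

lemma linear_subsystem_code_iff:
  fixes C :: "('a::{field,finite} ^ ('n::finite + 'n)) set"
  defines "D \<equiv> C \<inter> symp_dual C"
  shows "linear_subsystem_code C k r d \<longleftrightarrow>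
    vec.subspace C \<and> card C * CARD('a) ^ k = CARD('a) ^ (CARD('n) + r) \<and>
    card D * CARD('a) ^ (k + r) = CARD('a) ^ CARD('n) \<and>
    d = (if symp_dual D \<noteq> C then min_swt (symp_dual D - C) else min_swt (symp_dual D))"
proof -
  let ?q = "CARD('a)" and ?n = "CARD('n)"
  have "additive_code C" if "vec.subspace C"
    using that by (simp add: additive_code_def vec.subspace_0 vec.subspace_add vec.subspace_neg)
  moreover have "real (card C) = real ?q ^ ?n * real (?q ^ r) / real (?q ^ k)
      \<longleftrightarrow> real (card C * ?q ^ k) = real (?q ^ (?n + r))"
    by (simp add: eq_divide_eq power_add)
  moreover have "real (card D) = real ?q ^ ?n / (real (?q ^ k) * real (?q ^ r))
      \<longleftrightarrow> real (card D * ?q ^ (k + r)) = real (?q ^ ?n)"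
    by (simp add: eq_divide_eq power_add)
  ultimately show ?thesis
    unfolding linear_subsystem_code_def subsystem_code_def Let_def of_nat_eq_iff D_def by blast
qed

lemma min_swt_le: "v \<in> S \<Longrightarrow> v \<noteq> 0 \<Longrightarrow> min_swt S \<le> swt v"
  unfolding min_swt_def by (intro Min_le) auto

text \<open>The premise keeps \<open>Min\<close> away from the empty set, where its value is
  unspecified.\<close>

lemma le_min_swt_iff:
  assumes "\<not> S \<subseteq> {0}"
  shows "d \<le> min_swt S \<longleftrightarrow> (\<forall>v\<in>S. v \<noteq> 0 \<longrightarrow> d \<le> swt v)"
proof -
  have "swt ` (S - {0}) \<noteq> {}"
    using assms by blast
  then show ?thesis
    unfolding min_swt_def by (subst Min_ge_iff) auto
qed

text \<open>The common core of both claims. The weight bound concerns only the new vectors of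
  \<open>C'\<close>, so it can be combined with any purity of \<open>C\<close>.\<close>

lemma exchange_qudit:
  fixes C :: "('a::{field,finite} ^ ('n::finite + 'n)) set"
  assumes code: "linear_subsystem_code C k r d" and k: "k \<ge> 1"
  obtains C' :: "('a ^ ('n + 'n)) set" and dt
  where "linear_subsystem_code C' (k - 1) (r + 1) dt" "\<And>v. v \<in> C' - C \<Longrightarrow> d \<le> swt v"
    "k > 1 \<Longrightarrow> d \<le> dt" "k = 1 \<Longrightarrow> pure_to C d \<Longrightarrow> dt = d"
proof -
  let ?q = "CARD('a)" and ?n = "CARD('n)"
  define D where "D = C \<inter> symp_dual C"
  have C: "vec.subspace C" and cC: "card C * ?q ^ k = ?q ^ (?n + r)"
    and cD: "card D * ?q ^ (k + r) = ?q ^ ?n"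
    and d: "d = (if symp_dual D \<noteq> C then min_swt (symp_dual D - C) else min_swt (symp_dual D))"
    using code by (simp_all add: linear_subsystem_code_iff D_def)
  have q1: "?q > 1"
    by (rule CARD_field_gt_1)
  have D: "vec.subspace D"
    unfolding D_def by (intro vec.subspace_inter C subspace_symp_dual)
  \<comment> \<open>Otherwise \<open>card C * card D\<close> would be \<open>?q ^ (2 * ?n)\<close>,
    whereas the parameters make it smaller by the factor \<open>?q ^ (2 * k)\<close>.\<close>
  have proper: "\<not> symp_dual C \<subseteq> C"
  proof
    assume "symp_dual C \<subseteq> C"
    then have "D = symp_dual C"
      by (auto simp: D_def)
    then have "card C * card D = ?q ^ (2 * ?n)"
      using card_mult_card_symp_dual[OF C] by simp
    moreover have "(card C * ?q ^ k) * (card D * ?q ^ (k + r)) = ?q ^ (?n + r) * ?q ^ ?n"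
      by (simp only: cC cD)
    then have "(card C * card D) * ?q ^ (2 * k + r) = ?q ^ (2 * ?n + r)"
      by (simp add: power_add algebra_simps mult_2 mult_2_right)
    ultimately have "?q ^ (2 * ?n + (2 * k + r)) = ?q ^ (2 * ?n + r)"
      by (simp add: power_add)
    then show False
      using q1 k by simp
  qed
  obtain C' where C': "vec.subspace C'" "C \<subseteq> C'" and D': "C' \<inter> symp_dual C' = D"
    and cC': "card C' = card C * ?q\<^sup>2"
    using adjoin_hyperbolic_pair[OF C proper] unfolding D_def by blast
  \<comment> \<open>\<open>D\<close> lies in \<open>symp_dual C'\<close>; dualizing reverses the
    inclusion.\<close>
  have sub: "C' \<subseteq> symp_dual D"
  proof -
    have "symp_dual (symp_dual C') \<subseteq> symp_dual D"
      using D' by (auto simp: symp_dual_def)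
    then show ?thesis
      by (simp add: symp_dual_symp_dual[OF C'(1)])
  qed
  have "card C > 0"
    using vec.subspace_0[OF C] by (auto simp: card_gt_0_iff)
  then have "card C < card C'"
    using one_less_power[OF q1, of 2] by (simp add: cC')
  \<comment> \<open>\<open>C'\<close> lies strictly above \<open>C\<close> and inside
    \<open>symp_dual D\<close>, so \<open>d\<close> is given by the first branch of its
    definition.\<close>
  then have ne: "symp_dual D \<noteq> C"
    using C'(2) sub by auto
  have weight: "d \<le> swt v" if "v \<in> symp_dual D - C" for v
  proof -
    have "v \<noteq> 0"
      using that vec.subspace_0[OF C] by auto
    then show ?thesis
      using that ne d by (simp add: min_swt_le)
  qed
  have cC'_pow: "card C' * ?q ^ (k - 1) = ?q ^ (?n + (r + 1))"
  proof -
    have "card C' * ?q ^ (k - 1) = (card C * ?q ^ k) * ?q"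
      using k by (cases k) (simp_all add: cC' power2_eq_square)
    then show ?thesis
      by (simp add: cC)
  qed
  \<comment> \<open>Compared with \<open>cC'_pow\<close>, this shows that \<open>C'\<close> fills
    \<open>symp_dual D\<close> exactly when \<open>k = 1\<close>.\<close>
  have cDd: "card (symp_dual D) = ?q ^ (?n + k + r)"
  proof -
    have "card D * ?q ^ (?n + k + r) = (card D * ?q ^ (k + r)) * ?q ^ ?n"
      by (simp add: power_add)
    also have "\<dots> = card D * card (symp_dual D)"
      unfolding cD card_mult_card_symp_dual[OF D] by (simp add: mult_2 power_add)
    finally show ?thesis
      using cD q1 by auto
  qed
  define dt where
    "dt = (if symp_dual D \<noteq> C' then min_swt (symp_dual D - C') else min_swt (symp_dual D))"
  \<comment> \<open>As \<open>k \<ge> 1\<close>, the sum \<open>(k - 1) + (r + 1)\<close> is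
    \<open>k + r\<close>, so the equation for \<open>card D\<close> carries over.\<close>
  have "linear_subsystem_code C' (k - 1) (r + 1) dt"
    using C'(1) cC'_pow cD k by (simp add: linear_subsystem_code_iff D' dt_def)
  moreover have "d \<le> swt v" if "v \<in> C' - C" for v
    using weight that sub by blast
  moreover have "d \<le> dt" if "k > 1"
  proof -
    have "symp_dual D \<noteq> C'"
    proof
      assume "symp_dual D = C'"
      then have "?q ^ (?n + k + r + (k - 1)) = ?q ^ (?n + (r + 1))"
        using cC'_pow cDd by (simp only: power_add)
      then have "?n + k + r + (k - 1) = ?n + (r + 1)"
        using q1 power_inject_exp by blast
      then show False
        using that by simp
    qed
    then have dt: "dt = min_swt (symp_dual D - C')" and "\<not> symp_dual D - C' \<subseteq> {0}"
      using sub vec.subspace_0[OF C'(1)] by (auto simp: dt_def)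
    then show ?thesis
      using weight C'(2) by (auto simp: le_min_swt_iff)
  qed
  moreover have "dt = d" if "k = 1" and pure: "pure_to C d"
  proof -
    \<comment> \<open>The definition of the distance now switches to the minimum over all of
      \<open>symp_dual D\<close>.\<close>
    have "C' = symp_dual D"
      using that cC'_pow cDd by (intro card_subset_eq sub) simp_all
    then have dt: "dt = min_swt (symp_dual D)"
      by (simp add: dt_def)
    have nonzero: "\<not> symp_dual D - C \<subseteq> {0}"
      using ne C'(2) sub vec.subspace_0[OF C] by auto
    \<comment> \<open>Vectors outside \<open>C\<close> are bounded by \<open>weight\<close>, those
      in \<open>C\<close> by purity.\<close>
    then have "d \<le> dt"
      using weight pure by (subst dt, subst le_min_swt_iff) (auto simp: pure_to_def not_less)
    \<comment> \<open>The minimum \<open>dt\<close> is taken over a larger set than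
      \<open>d\<close>.\<close>
    moreover have "dt \<le> d"
      using nonzero ne d dt by (simp add: le_min_swt_iff min_swt_le)
    ultimately show ?thesis
      by simp
  qed
  ultimately show thesis
    using that by blast
qed

theorem theorem11:
  fixes p m q :: nat
  assumes "prime p" and "m \<ge> 1" and "q = p ^ m" and "CARD('a::{field,finite}) = q"
  shows
    "(\<forall>k r d d'. k > 1 \<longrightarrow>
        (\<exists>C :: ('a ^ ('n::finite + 'n)) set.
           linear_subsystem_code C k r d \<and> pure_to C d') \<longrightarrow>
        (\<exists>(C' :: ('a ^ ('n + 'n)) set) dt.
           dt \<ge> d \<and> linear_subsystem_code C' (k - 1) (r + 1) dt \<and> pure_to C' (min d d'))) \<and>
     (\<forall>r d.
        (\<exists>C :: ('a ^ ('n + 'n)) set. linear_subsystem_code C 1 r d \<and> pure_to C d) \<longrightarrow>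
        (\<exists>C' :: ('a ^ ('n + 'n)) set. linear_subsystem_code C' 0 (r + 1) d))"
proof (intro conjI allI impI; elim exE conjE)
  fix k r d d' :: nat and C :: "('a ^ ('n + 'n)) set"
  assume k: "k > 1" and code: "linear_subsystem_code C k r d" and pure: "pure_to C d'"
  obtain C' :: "('a ^ ('n + 'n)) set" and dt
    where C': "linear_subsystem_code C' (k - 1) (r + 1) dt" "d \<le> dt"
      and weight: "\<And>v. v \<in> C' - C \<Longrightarrow> d \<le> swt v"
    using exchange_qudit[OF code] k by (metis less_imp_le)
  have "pure_to C' (min d d')"
    unfolding pure_to_def
  proof (intro ballI impI)
    \<comment> \<open>Old vectors have weight at least \<open>d'\<close>, new ones at least
      \<open>d\<close>; hence the minimum.\<close>
    fix v assume "v \<in> C'" "v \<noteq> 0"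
    then show "\<not> swt v < min d d'"
      using weight[of v] pure by (cases "v \<in> C") (auto simp: pure_to_def)
  qed
  with C' show "\<exists>(C' :: ('a ^ ('n + 'n)) set) dt.
      dt \<ge> d \<and> linear_subsystem_code C' (k - 1) (r + 1) dt \<and> pure_to C' (min d d')"
    by blast
next
  fix r d :: nat and C :: "('a ^ ('n + 'n)) set"
  assume code: "linear_subsystem_code C 1 r d" and pure: "pure_to C d"
  obtain C' :: "('a ^ ('n + 'n)) set" and dt
    where "linear_subsystem_code C' (1 - 1) (r + 1) dt" "dt = d"
    using exchange_qudit[OF code] pure by (metis order_refl)
  then show "\<exists>C' :: ('a ^ ('n + 'n)) set. linear_subsystem_code C' 0 (r + 1) d"
    by auto
qed

end
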